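(* For every real $\alpha<1$ there exist a Turing transducer $T\in\mathcal{T}$ and a real number $\beta$ with $\alpha<\beta<1$ such that, for any choice of initial word $w_0\in L$ (where $L$ is the language of inputs accepted by $T$, which is nonempty), the average length growth function $\ell_n$ of the pair $(T,w_0)$ satisfies $\ell_n\asymp n^\beta$ and the growth function $b_n$ of the pair $(T,w_0)$ is exponential.
   Context: **Class $\mathcal{T}$.** A $(k+1)$-tape Turing transducer ($k\geqslant 1$) is a deterministic multi-tape Turing machine with one input tape and $k$ output tapes. The class $\mathcal{T}$ consists of those $(k+1)$-tape Turing transducers $T$ (for any $k\geqslant 1$ and any finite input alphabet $\Sigma$) that work as follows on every input $x\in\Sigma^*$. Initially $x$ is on the input tape, the output tapes are completely blank, and all heads are over the leftmost cells. First all heads move synchronously from left to right until the end of the input $x$; then they make a finite number (possibly zero) of further steps to the right, this number being bounded above by a constant depending only on $T$; after that all heads move synchronously from right to left until $T$ enters a final state with all heads over the leftmost cells. $T$ accepts $x$ if this final state is accepting, otherwise it rejects $x$. Let $L\subseteq\Sigma^*$ be the set of inputs accepted by $T$. For $x\in L$, $T$ translates $x$ into the outputs $y_1,\dots,y_k$ if, on input $x$, $T$ halts with the word $y_i$ on the $i$th output tape for $i=1,\dots,k$. It is required that $y_i\in L$ for all $x\in L$ and all $i$. **Growth function.** For $w\in L$ let $T(w)$ be the set of the $k$ outputs of $T$ on $w$, and for $W\subseteq L$ let $T(W)=\bigcup_{w\in W}T(w)$. For $w_0\in L$ put $W_0=\{w_0\}$, $W_{i+1}=T(W_i)$, $V_n=\bigcup_{i=0}^nW_i$.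 The growth function of $(T,w_0)$ is $b_n=\#V_n$, $n=0,1,2,\dots$. It is exponential if $b_n\geqslant c\,\lambda^n$ for all $n$, for some constants $c>0$, $\lambda>1$. **Average length growth function.** For a finite multiset $M$ of words of $L$, $T(M)$ is the multiset obtained by adding, for each word $w$ in $M$ (repeated according to its multiplicity), all $k$ outputs of $T$ on $w$ (with repetition). Let $M_0$ consist of $w_0$ with multiplicity one and $M_{i+1}=T(M_i)$; so $M_n$ has $k^n$ elements counted with multiplicity. The average length growth function of $(T,w_0)$ is $\ell_n=\frac{1}{k^n}\sum_{w\in M_n}m_w|w|$, $n=1,2,\dots$, where $m_w$ is the multiplicity of $w$ in $M_n$ and $|w|$ is the length of $w$. **Notation.** $g(n)\asymp f(n)$ means that there are constants $\delta_2\geqslant\delta_1>0$ with $\delta_1f(n)\leqslant g(n)\leqslant\delta_2f(n)$ for all $n\geqslant 1$. *)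

theory Defs
  imports Complex_Main "HOL-Library.Multiset"
begin

datatype move = Move_Left | Stay | Move_Right

(* A machine with one input tape and num_out output tapes.  Lists of tapes, heads, scanned symbols,
   written symbols and moves have length num_out + 1; index 0 is the input tape and index i + 1 is
   the i-th output tape (i < num_out).  The final states are the accepting and the rejecting ones. *)
record ('q, 's) transducer =
  num_out :: nat
  states :: "'q set"
  in_alph :: "'s set"
  tape_alph :: "'s set"
  blank :: 's
  init_state :: 'q
  acc_states :: "'q set"
  rej_states :: "'q set"
  trans :: "'q \<Rightarrow> 's list \<Rightarrow> 'q \<times> 's list \<times> move list"

definition final_states :: "('q, 's) transducer \<Rightarrow> 'q set" where
  "final_states T = acc_states T \<union> rej_states T"

(* The last conjunct of the transition clause makes the input tape read-only. *)
definition turing_transducer :: "('q, 's) transducer \<Rightarrow> bool" where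
  "turing_transducer T \<longleftrightarrow>
     num_out T \<ge> 1 \<and>
     finite (states T) \<and> finite (tape_alph T) \<and>
     in_alph T \<subseteq> tape_alph T \<and> blank T \<in> tape_alph T \<and> blank T \<notin> in_alph T \<and>
     init_state T \<in> states T \<and> acc_states T \<subseteq> states T \<and> rej_states T \<subseteq> states T \<and>
     acc_states T \<inter> rej_states T = {} \<and>
     (\<forall>q \<in> states T - final_states T. \<forall>ss \<in> lists (tape_alph T). length ss = num_out T + 1 \<longrightarrow>
        (case trans T q ss of (q', ws, ms) \<Rightarrow>
           q' \<in> states T \<and>
           ws \<in> lists (tape_alph T) \<and> length ws = num_out T + 1 \<and>
           length ms = num_out T + 1 \<and>
           ws ! 0 = ss ! 0))"

(* Tapes are infinite to the right only; cell 0 is the leftmost cell. *)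
record ('q, 's) config =
  state :: 'q
  tapes :: "(nat \<Rightarrow> 's) list"
  heads :: "nat list"

(* A left move on the leftmost cell leaves the head there. *)
fun move_head :: "move \<Rightarrow> nat \<Rightarrow> nat" where
  "move_head Move_Left p = p - 1"
| "move_head Stay p = p"
| "move_head Move_Right p = p + 1"

definition step :: "('q, 's) transducer \<Rightarrow> ('q, 's) config \<Rightarrow> ('q, 's) config" where
  "step T c =
     (let I = [0..<num_out T + 1];
          (q, ws, ms) = trans T (state c) (map (\<lambda>i. (tapes c ! i) (heads c ! i)) I)
      in \<lparr> state = q,
           tapes = map (\<lambda>i. (tapes c ! i)(heads c ! i := ws ! i)) I,
           heads = map (\<lambda>i. move_head (ms ! i) (heads c ! i)) I \<rparr>)"

definition word_tape :: "'s \<Rightarrow> 's list \<Rightarrow> nat \<Rightarrow> 's" where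
  "word_tape b w = (\<lambda>n. if n < length w then w ! n else b)"

definition init_config :: "('q, 's) transducer \<Rightarrow> 's list \<Rightarrow> ('q, 's) config" where
  "init_config T x =
     \<lparr> state = init_state T,
       tapes = word_tape (blank T) x # replicate (num_out T) (word_tape (blank T) []),
       heads = replicate (num_out T + 1) 0 \<rparr>"

definition config_at :: "('q, 's) transducer \<Rightarrow> 's list \<Rightarrow> nat \<Rightarrow> ('q, 's) config" where
  "config_at T x t = (step T ^^ t) (init_config T x)"

definition halts_at :: "('q, 's) transducer \<Rightarrow> 's list \<Rightarrow> nat \<Rightarrow> bool" where
  "halts_at T x h \<longleftrightarrow>
     state (config_at T x h) \<in> final_states T \<and>
     (\<forall>t<h. state (config_at T x t) \<notin> final_states T)"

definition lang :: "('q, 's) transducer \<Rightarrow> 's list set" where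
  "lang T = {x \<in> lists (in_alph T). \<exists>h. halts_at T x h \<and> state (config_at T x h) \<in> acc_states T}"

definition translates :: "('q, 's) transducer \<Rightarrow> 's list \<Rightarrow> 's list list \<Rightarrow> bool" where
  "translates T x ys \<longleftrightarrow>
     length ys = num_out T \<and> set ys \<subseteq> lists (in_alph T) \<and>
     (\<exists>h. halts_at T x h \<and>
        (\<forall>i<num_out T. tapes (config_at T x h) ! (i + 1) = word_tape (blank T) (ys ! i)))"

(* On input x the heads take r steps to the right, where cell length x is the first cell after the
   input, so at most C of these steps lead beyond the end of the input; then they go left.  The heads
   are back on the leftmost cells at time 2 * r, and the machine halts there, at the latest after the
   one transition that reads and rewrites the leftmost cells on the way back (time 2 * r + 1); the
   truncated difference 2 * r - t is 0 at both of these times. *)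
definition two_pass_run :: "('q, 's) transducer \<Rightarrow> nat \<Rightarrow> 's list \<Rightarrow> bool" where
  "two_pass_run T C x \<longleftrightarrow>
     (\<exists>r h. length x \<le> r \<and> r \<le> length x + C \<and> 2 * r \<le> h \<and> h \<le> 2 * r + 1 \<and>
        halts_at T x h \<and>
        (\<forall>t\<le>r. heads (config_at T x t) = replicate (num_out T + 1) t) \<and>
        (\<forall>t. r \<le> t \<and> t \<le> h \<longrightarrow> heads (config_at T x t) = replicate (num_out T + 1) (2 * r - t)))"

definition class_T :: "('q, 's) transducer set" where
  "class_T = {T. turing_transducer T \<and>
     (\<exists>C. \<forall>x \<in> lists (in_alph T). two_pass_run T C x) \<and>
     (\<forall>x \<in> lang T. \<exists>ys. translates T x ys \<and> set ys \<subseteq> lang T)}"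

(* The description operator is justified by translates_unique below. *)
definition outputs :: "('q, 's) transducer \<Rightarrow> 's list \<Rightarrow> 's list list" where
  "outputs T x = (THE ys. translates T x ys)"

lemma halts_at_unique: "halts_at T x h \<Longrightarrow> halts_at T x h' \<Longrightarrow> h = h'"
  unfolding halts_at_def by (metis linorder_neqE_nat)

lemma word_tape_inj:
  assumes "word_tape b v = word_tape b w" and "b \<notin> set v" and "b \<notin> set w"
  shows "v = w"
proof -
  have len: "length u \<le> length u'" if "word_tape b u = word_tape b u'" "b \<notin> set u" for u u'
  proof (rule ccontr)
    assume "\<not> length u \<le> length u'"
    then have *: "length u' < length u" by simp
    have "word_tape b u (length u') = b" using that(1) by (simp add: word_tape_def)
    then show False using * that(2) by (auto simp: word_tape_def dest: nth_mem)
  qed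
  have "length v = length w"
    using len[OF assms(1,2)] len[OF assms(1)[symmetric] assms(3)] by simp
  moreover have "v ! n = w ! n" if "n < length v" for n
    using fun_cong[OF assms(1), of n] that calculation by (simp add: word_tape_def)
  ultimately show ?thesis by (rule nth_equalityI)
qed

lemma translates_unique:
  assumes "blank T \<notin> in_alph T" and "translates T x ys" and "translates T x zs"
  shows "ys = zs"
proof (rule nth_equalityI)
  show len: "length ys = length zs" using assms(2,3) by (simp add: translates_def)
  obtain h where h: "halts_at T x h"
      "\<forall>i<num_out T. tapes (config_at T x h) ! (i + 1) = word_tape (blank T) (ys ! i)"
    using assms(2) by (auto simp: translates_def)
  obtain h' where h': "halts_at T x h'"
      "\<forall>i<num_out T. tapes (config_at T x h') ! (i + 1) = word_tape (blank T) (zs ! i)"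
    using assms(3) by (auto simp: translates_def)
  fix i assume i: "i < length ys"
  have eq: "h = h'" using h(1) h'(1) by (rule halts_at_unique)
  have k: "length ys = num_out T" using assms(2) by (simp add: translates_def)
  have "ys ! i \<in> set ys" "zs ! i \<in> set zs" using i len by auto
  then have "set (ys ! i) \<subseteq> in_alph T" "set (zs ! i) \<subseteq> in_alph T"
    using assms(2,3) by (fastforce simp: translates_def)+
  moreover have "word_tape (blank T) (ys ! i) = word_tape (blank T) (zs ! i)"
    using h(2) h'(2) eq i k by metis
  ultimately show "ys ! i = zs ! i" using assms(1) by (intro word_tape_inj) auto
qed

primrec gen_set :: "('q, 's) transducer \<Rightarrow> 's list \<Rightarrow> nat \<Rightarrow> 's list set" where
  "gen_set T w0 0 = {w0}"
| "gen_set T w0 (Suc i) = (\<Union>w \<in> gen_set T w0 i. set (outputs T w))"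

definition growth :: "('q, 's) transducer \<Rightarrow> 's list \<Rightarrow> nat \<Rightarrow> nat" where
  "growth T w0 n = card (\<Union>i\<le>n. gen_set T w0 i)"

definition exponential_growth :: "(nat \<Rightarrow> nat) \<Rightarrow> bool" where
  "exponential_growth b \<longleftrightarrow> (\<exists>c \<mu>::real. c > 0 \<and> \<mu> > 1 \<and> (\<forall>n. real (b n) \<ge> c * \<mu> ^ n))"

primrec gen_mset :: "('q, 's) transducer \<Rightarrow> 's list \<Rightarrow> nat \<Rightarrow> 's list multiset" where
  "gen_mset T w0 0 = {#w0#}"
| "gen_mset T w0 (Suc i) = (\<Sum>w \<in># gen_mset T w0 i. mset (outputs T w))"

definition avg_length :: "('q, 's) transducer \<Rightarrow> 's list \<Rightarrow> nat \<Rightarrow> real" where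
  "avg_length T w0 n =
     1 / real (num_out T) ^ n *
       (\<Sum>w \<in> set_mset (gen_mset T w0 n). real (count (gen_mset T w0 n) w) * real (length w))"

definition same_order :: "(nat \<Rightarrow> real) \<Rightarrow> (nat \<Rightarrow> real) \<Rightarrow> bool" where
  "same_order g f \<longleftrightarrow>
     (\<exists>\<delta>\<^sub>1 \<delta>\<^sub>2. 0 < \<delta>\<^sub>1 \<and> \<delta>\<^sub>1 \<le> \<delta>\<^sub>2 \<and> (\<forall>n\<ge>1. \<delta>\<^sub>1 * f n \<le> g n \<and> g n \<le> \<delta>\<^sub>2 * f n))"

end

theory Submission
  imports Defs
begin

text \<open>
  A word is read as a counter in base \<open>b + 1\<close>, least significant digit first, followed by a junk suffix
  that starts at the first letter outside \<open>{..b}\<close>. Of the four outputs of a word \<open>x\<close>, two append one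
  of the two junk letters to \<open>x\<close>; the other two coincide: they drop the junk, increment the counter and
  append one more digit (the carry) precisely when the new value has no digit \<open>b\<close>. About
  \<open>n\<^sup>\<beta>\<close> numbers below \<open>n\<close> have no digit \<open>b\<close>, where \<open>\<beta> = ln b / ln (b + 1)\<close>, so the counter has
  length of order \<open>i\<^sup>\<beta>\<close> after \<open>i\<close> increments. Along a random path half of the steps are increments
  and the expected length of the junk is bounded, whence the average length is of order \<open>n\<^sup>\<beta>\<close>,
  while the junk alone accounts for \<open>2\<^sup>n\<close> distinct words at time \<open>n\<close>. Finally
  \<open>\<beta> \<longrightarrow> 1\<close> as \<open>b\<close> grows.
\<close>

section \<open>Numbers with no digit \<open>b\<close> in base \<open>b + 1\<close>\<close>

text \<open>Leading zeros are ignored. The disjunct \<open>b = 0\<close> secures termination, as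
  division by 1 would not decrease \<open>n\<close>.\<close>

function good :: "nat \<Rightarrow> nat \<Rightarrow> bool" where
  "good b n = (if n = 0 \<or> b = 0 then True else n mod Suc b \<noteq> b \<and> good b (n div Suc b))"
  by auto
termination by (relation "measure snd") auto

declare good.simps [simp del]

definition good_count :: "nat \<Rightarrow> nat \<Rightarrow> nat" where
  "good_count b n = (\<Sum>s<n. of_bool (good b s))"

lemma good_0 [simp]: "good b 0"
  by (simp add: good.simps)

text \<open>The case \<open>n = 0\<close> is included, so the leading zeros that the counter
  produces do no harm.\<close>

lemma good_digit:
  assumes "0 < b" "r \<le> b"
  shows "good b (r + Suc b * n) \<longleftrightarrow> r \<noteq> b \<and> good b n"
proof (cases "r + Suc b * n = 0")
  case True
  then show ?thesis using assms by simp
next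
  case False
  have "(r + Suc b * n) mod Suc b = r" "(r + Suc b * n) div Suc b = n"
    using assms by (simp_all only: mod_mult_self2 div_mult_self2 mod_less div_less less_Suc_eq_le)
  then show ?thesis
    using assms(1) False good.simps[of b "r + Suc b * n"] by (simp del: mult_Suc)
qed

lemma good_count_mono: "m \<le> n \<Longrightarrow> good_count b m \<le> good_count b n"
  unfolding good_count_def by (intro sum_mono2) auto

text \<open>Each block of \<open>b + 1\<close> consecutive numbers with the same higher part
  \<open>m\<close> has \<open>b\<close> good members if \<open>m\<close> is good and none
  otherwise.\<close>

lemma good_count_mult:
  assumes "0 < b"
  shows "good_count b (n * Suc b) = b * good_count b n"
proof -
  have "(\<Sum>s = m * Suc b..<m * Suc b + Suc b. of_bool (good b s)) = b * of_bool (good b m)" for m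
  proof -
    have "(\<Sum>s = m * Suc b..<m * Suc b + Suc b. of_bool (good b s))
        = (\<Sum>r<Suc b. of_bool (good b (r + Suc b * m)))"
      by (rule sum.reindex_bij_witness[of _ "\<lambda>r. r + m * Suc b" "\<lambda>s. s - m * Suc b"])
         (auto simp: mult.commute)
    also have "\<dots> = (\<Sum>r<Suc b. if r < b then of_bool (good b m) else 0)"
      by (rule sum.cong) (use assms good_digit in auto)
    also have "\<dots> = (\<Sum>r<b. of_bool (good b m))"
      by simp
    also have "\<dots> = b * of_bool (good b m)"
      by (simp only: sum_constant card_lessThan) simp
    finally show ?thesis .
  qed
  then show ?thesis
    unfolding good_count_def sum.nat_group[symmetric] sum_distrib_left by (intro sum.cong) auto
qed

lemma good_count_power: "0 < b \<Longrightarrow> good_count b (Suc b ^ j) = b ^ j"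
proof (induction j)
  case 0
  then show ?case by (simp add: good_count_def)
next
  case (Suc j)
  then show ?case using good_count_mult[of b "Suc b ^ j"] by (simp add: mult.commute)
qed

text \<open>At powers of \<open>b + 1\<close> the count is exactly \<open>n powr \<beta>\<close>;
  between consecutive powers monotonicity costs a factor \<open>b\<close>.\<close>

lemma good_count_powr_bounds:
  fixes \<beta> :: real
  assumes b: "2 \<le> b" and n: "0 < n"
  defines "\<beta> \<equiv> ln (real b) / ln (real (Suc b))"
  shows "real n powr \<beta> / real b \<le> real (good_count b n)"
    and "real (good_count b n) \<le> real b * real n powr \<beta>"
proof -
  have \<beta>: "0 < \<beta>" using b by (simp add: \<beta>_def)
  have pw: "real (Suc b ^ j) powr \<beta> = real b ^ j" for j
  proof -
    have "real (Suc b ^ j) powr \<beta> = exp (\<beta> * (real j * ln (real (Suc b))))"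
      by (simp add: powr_def ln_realpow)
    also have "\<beta> * (real j * ln (real (Suc b))) = real j * ln (real b)"
      using b by (simp add: \<beta>_def)
    also have "exp \<dots> = real b ^ j"
      using b by (simp add: exp_of_nat_mult)
    finally show ?thesis .
  qed
  obtain j where j: "Suc b ^ j \<le> n" "n < Suc b ^ Suc j"
    using ex_power_ivl1[of "Suc b" n] b n by auto
  have "real n powr \<beta> \<le> real (Suc b ^ Suc j) powr \<beta>"
    using j(2) \<beta> by (intro powr_mono2) (auto simp only: of_nat_le_iff)
  also have "\<dots> = real b * real (good_count b (Suc b ^ j))"
    using b by (simp only: pw good_count_power) simp
  also have "\<dots> \<le> real b * real (good_count b n)"
    using good_count_mono[OF j(1)] by (intro mult_left_mono) auto
  finally show "real n powr \<beta> / real b \<le> real (good_count b n)"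
    using b by (simp add: field_simps)
  have "real (good_count b n) \<le> real (good_count b (Suc b ^ Suc j))"
    using good_count_mono j(2) by (simp only: of_nat_le_iff less_imp_le)
  also have "\<dots> = real b * real (Suc b ^ j) powr \<beta>"
    using b by (simp only: pw good_count_power) simp
  also have "\<dots> \<le> real b * real n powr \<beta>"
    using j(1) \<beta> by (intro mult_left_mono powr_mono2) (auto simp only: of_nat_le_iff)
  finally show "real (good_count b n) \<le> real b * real n powr \<beta>" .
qed


section \<open>The counter\<close>

text \<open>
  The letters are the digits \<open>0, \<dots>, b\<close>, the junk letters \<open>b + 1\<close> and \<open>b + 2\<close>, the blank, and a marker
  by which the machine recognises the leftmost cell on its way back. In state \<open>q_carry\<close> all digits
  written so far are \<open>0\<close>; in \<open>q_ok\<close> and \<open>q_bad\<close> there is no carry, and \<open>q_bad\<close> records that a digit \<open>b\<close> has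
  been written; \<open>q_init\<close> differs from \<open>q_carry\<close> only in setting the marker.
\<close>
definition blk :: "nat \<Rightarrow> nat" where "blk b = b + 3"
definition mrk :: "nat \<Rightarrow> nat" where "mrk b = b + 4"

abbreviation (input) "q_drop \<equiv> 0 :: nat"
abbreviation (input) "q_bad \<equiv> 1 :: nat"
abbreviation (input) "q_ok \<equiv> 2 :: nat"
abbreviation (input) "q_carry \<equiv> 3 :: nat"
abbreviation (input) "q_init \<equiv> 4 :: nat"
abbreviation (input) "q_back \<equiv> 5 :: nat"
abbreviation (input) "q_fin \<equiv> 6 :: nat"

definition carrying :: "nat \<Rightarrow> bool" where
  "carrying q \<longleftrightarrow> q = q_carry \<or> q = q_init"

definition nxt :: "nat \<Rightarrow> nat \<Rightarrow> nat \<Rightarrow> nat" where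
  "nxt b q s =
     (if b < s \<or> q = q_drop then q_drop
      else if carrying q then (if s = b then q_carry else if s + 1 = b then q_bad else q_ok)
      else if s = b then q_bad else q)"

text \<open>The first letter above \<open>b\<close>, possibly the blank, closes the number: a
  pending carry becomes a top digit 1, \<open>q_ok\<close> adds a leading zero, \<open>q_bad\<close>
  adds nothing. For \<open>b \<ge> 2\<close> the number written is good exactly in the first two
  cases.\<close>

definition out :: "nat \<Rightarrow> nat \<Rightarrow> nat \<Rightarrow> nat" where
  "out b q s =
     (if q = q_drop then blk b
      else if b < s then (if carrying q then 1 else if q = q_ok then 0 else blk b)
      else if carrying q then (if s = b then 0 else s + 1)
      else s)"

text \<open>A blank output ends the word. The first equation accounts for the cell just beyond the
  input, where the blank is read.\<close>

primrec run :: "nat \<Rightarrow> nat \<Rightarrow> nat list \<Rightarrow> nat list" where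
  "run b q [] = (if out b q (blk b) = blk b then [] else [out b q (blk b)])"
| "run b q (s # x) = (if out b q s = blk b then [] else out b q s # run b (nxt b q s) x)"

abbreviation inc :: "nat \<Rightarrow> nat list \<Rightarrow> nat list" where
  "inc b \<equiv> run b q_init"

definition digits :: "nat \<Rightarrow> nat list \<Rightarrow> nat list" where
  "digits b x = takeWhile (\<lambda>s. s \<le> b) x"

definition val :: "nat \<Rightarrow> nat list \<Rightarrow> nat" where
  "val b x = foldr (\<lambda>s n. s + Suc b * n) x 0"

lemma val_simps [simp]: "val b [] = 0" "val b (s # x) = s + Suc b * val b x"
  by (simp_all add: val_def)

lemmas machine_simps = nxt_def out_def carrying_def blk_def

lemma out_drop [simp]: "out b q_drop s = blk b"
  by (simp add: out_def)

lemma run_drop: "run b q_drop x = []"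
  by (cases x) (simp_all add: machine_simps)

text \<open>A letter above \<open>b\<close> and the blank are treated alike, so it does not matter
  which of them ends the digits.\<close>

lemma run_snoc:
  assumes "b < s"
  shows "run b q (x @ [s]) = run b q x"
proof (induction x arbitrary: q)
  case Nil
  have "out b q s = out b q (blk b)" "nxt b q s = q_drop"
    using assms by (auto simp: machine_simps)
  then show ?case by (simp add: run_drop)
qed simp

lemma run_in_digits: "2 \<le> b \<Longrightarrow> set (run b q x) \<subseteq> {..b}"
proof (induction x arbitrary: q)
  case Nil
  then show ?case by (auto simp: machine_simps)
next
  case (Cons s x)
  have "out b q s \<le> b \<or> out b q s = blk b" using Cons.prems by (auto simp: machine_simps)
  then show ?case using Cons by auto
qed

lemma digits_run: "2 \<le> b \<Longrightarrow> digits b (run b q x) = run b q x"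
  unfolding digits_def using run_in_digits[of b q x] by (auto simp: takeWhile_eq_all_conv)

lemma run_bad: "run b q_bad x = digits b x"
  by (induction x) (auto simp: digits_def machine_simps run_drop[unfolded machine_simps])

text \<open>Digits are copied, and an extra digit can only be a leading zero, which leaves the value
  unchanged.\<close>

lemma run_ok:
  assumes "0 < b"
  shows "val b (run b q_ok x) = val b (digits b x) \<and>
    length (run b q_ok x) = length (digits b x) + of_bool (good b (val b (digits b x)))"
proof (induction x)
  case Nil
  then show ?case by (simp add: digits_def machine_simps)
next
  case (Cons s x)
  consider "b < s" | "s = b" | "s < b" by linarith
  then show ?case
  proof cases
    case 1
    then show ?thesis using assms by (simp add: digits_def machine_simps run_drop[unfolded machine_simps])
  next
    case 2
    then have "run b q_ok (s # x) = s # digits b x"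
      using assms run_bad[of b x] by (simp add: machine_simps)
    moreover have "digits b (s # x) = s # digits b x" using 2 by (simp add: digits_def)
    moreover have "\<not> good b (s + Suc b * val b (digits b x))"
      using good_digit[OF assms, of s] 2 by blast
    ultimately show ?thesis by simp
  next
    case 3
    then have "run b q_ok (s # x) = s # run b q_ok x"
      using assms by (simp add: machine_simps)
    moreover have "digits b (s # x) = s # digits b x" using 3 by (simp add: digits_def)
    moreover have "good b (s + Suc b * val b (digits b x)) \<longleftrightarrow> good b (val b (digits b x))"
      using good_digit[OF assms, of s] 3 by auto
    ultimately show ?thesis using Cons by simp
  qed
qed

text \<open>Induction along the carry: \<open>s = b\<close> writes 0 and passes the carry on;
  \<open>s + 1 = b\<close> creates a digit \<open>b\<close>, so the new value is not good; a smaller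
  digit absorbs the carry and leaves goodness to the higher digits.\<close>

lemma run_carrying:
  assumes b: "2 \<le> b" and "carrying q"
  shows "val b (run b q x) = Suc (val b (digits b x)) \<and>
    length (run b q x) = length (digits b x) + of_bool (good b (Suc (val b (digits b x))))"
  using assms(2)
proof (induction x arbitrary: q)
  case Nil
  \<comment> \<open>A final carry writes the digit 1, which differs from \<open>b\<close> because
    \<open>2 \<le> b\<close>.\<close>
  have "good b 1" using good_digit[of b 1 0] b by simp
  then show ?case using b Nil by (auto simp: digits_def machine_simps)
next
  case (Cons s x)
  have b0: "0 < b" using b by simp
  consider "b < s" | "s = b" | "s + 1 = b" | "s + 1 < b" by linarith
  then show ?case
  proof cases
    case 1
    have "good b 1" using good_digit[of b 1 0] b by simp
    then show ?thesis using 1 b Cons.prems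
      by (auto simp: digits_def machine_simps run_drop[unfolded machine_simps])
  next
    case 2
    then have "run b q (s # x) = 0 # run b q_carry x"
      using b Cons.prems by (auto simp: machine_simps)
    moreover have "digits b (s # x) = b # digits b x" using 2 by (simp add: digits_def)
    moreover have "good b (Suc b * Suc (val b (digits b x))) \<longleftrightarrow> good b (Suc (val b (digits b x)))"
      using good_digit[OF b0, of 0 "Suc (val b (digits b x))"] b
      by (simp only: add_0 le0 simp_thms) simp
    moreover have "Suc (b + Suc b * val b (digits b x)) = Suc b * Suc (val b (digits b x))"
      by simp
    moreover have "carrying q_carry" by (simp add: carrying_def)
    ultimately show ?thesis
      using Cons.IH[of q_carry] by (simp only: val_simps list.size add_0 add_Suc_right) simp
  next
    case 3
    then have "run b q (s # x) = b # digits b x"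
      using b Cons.prems run_bad[of b x] by (auto simp: machine_simps)
    moreover have "digits b (s # x) = s # digits b x" using 3 by (simp add: digits_def)
    moreover have "\<not> good b (b + Suc b * val b (digits b x))"
      using good_digit[OF b0, of b] by blast
    moreover have "Suc (s + Suc b * val b (digits b x)) = b + Suc b * val b (digits b x)"
      using 3 by simp
    ultimately show ?thesis by (simp only: val_simps list.size of_bool_eq) simp
  next
    case 4
    then have "run b q (s # x) = Suc s # run b q_ok x"
      using b Cons.prems by (auto simp: machine_simps)
    moreover have "digits b (s # x) = s # digits b x" using 4 by (simp add: digits_def)
    moreover have "good b (Suc s + Suc b * val b (digits b x)) \<longleftrightarrow> good b (val b (digits b x))"
      using good_digit[OF b0, of "Suc s"] 4 by auto
    ultimately show ?thesis using run_ok[OF b0, of x] by simp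
  qed
qed

text \<open>The gains in length telescope to a difference of good counts, written additively to
  avoid truncated subtraction.\<close>

lemma inc_iterate:
  assumes b: "2 \<le> b"
  shows "val b (digits b ((inc b ^^ i) x)) = val b (digits b x) + i \<and>
    length (digits b ((inc b ^^ i) x)) + good_count b (Suc (val b (digits b x))) =
      length (digits b x) + good_count b (Suc (val b (digits b x) + i))"
proof (induction i)
  case (Suc i)
  then show ?case
    using run_carrying[OF b, of q_init "(inc b ^^ i) x"]
    by (simp add: digits_run[OF b] carrying_def good_count_def)
qed simp

text \<open>An increment yields digits only, so junk can contribute only at \<open>i = 0\<close>,
  where \<open>length x\<close> covers it.\<close>

lemma length_inc_iterate:
  assumes b: "2 \<le> b"
  shows "length ((inc b ^^ i) x) \<le> length x + good_count b (Suc (val b (digits b x) + i))"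
    and "0 < i \<Longrightarrow> good_count b (Suc (val b (digits b x) + i)) \<le>
      length ((inc b ^^ i) x) + good_count b (Suc (val b (digits b x)))"
proof -
  have d: "digits b ((inc b ^^ i) x) = (inc b ^^ i) x" if "0 < i"
    using that by (cases i) (simp_all add: digits_run[OF b])
  have "length (digits b x) \<le> length x" by (simp add: digits_def length_takeWhile_le)
  then show "length ((inc b ^^ i) x) \<le> length x + good_count b (Suc (val b (digits b x) + i))"
    using inc_iterate[OF b, of i x] d by (cases "i = 0") auto
  show "good_count b (Suc (val b (digits b x) + i)) \<le>
      length ((inc b ^^ i) x) + good_count b (Suc (val b (digits b x)))" if "0 < i"
    using inc_iterate[OF b, of i x] d that by auto
qed


section \<open>The machine\<close>

text \<open>
  Output tape 1 carries the marker. On the way back its leftmost letter is restored from the input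
  tape. The empty input needs no marker, as the machine halts after one step.
\<close>
definition trf :: "nat \<Rightarrow> nat \<Rightarrow> nat list \<Rightarrow> nat \<times> nat list \<times> move list" where
  "trf b q ss =
     (let s = ss ! 0 in
      if q = q_back then
        (if ss ! 1 = mrk b then (q_fin, [s, s, ss ! 2, ss ! 3, ss ! 4], replicate 5 Move_Left)
         else (q_back, ss, replicate 5 Move_Left))
      else if s = blk b then
        (if q = q_init then q_fin else q_back,
         [s, b + 1, b + 2, out b q s, out b q s], replicate 5 Move_Left)
      else
        (nxt b q s, [s, if q = q_init then mrk b else s, s, out b q s, out b q s],
         replicate 5 Move_Right))"

text \<open>All words over the input alphabet are to be accepted, so closure of the language under
  the outputs only asks that these use input letters again.\<close>

definition machine :: "nat \<Rightarrow> (nat, nat) transducer" where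
  "machine b = \<lparr> num_out = 4, states = {..6}, in_alph = {..b + 2}, tape_alph = {..b + 4},
     blank = blk b, init_state = q_init, acc_states = {q_fin}, rej_states = {}, trans = trf b \<rparr>"

lemma machine_sel [simp]:
  "num_out (machine b) = 4" "states (machine b) = {..6}" "in_alph (machine b) = {..b + 2}"
  "tape_alph (machine b) = {..b + 4}" "blank (machine b) = blk b"
  "init_state (machine b) = q_init" "acc_states (machine b) = {q_fin}"
  "rej_states (machine b) = {}" "trans (machine b) = trf b"
  "final_states (machine b) = {q_fin}"
  by (simp_all add: machine_def final_states_def)

lemma turing_transducer_machine: "turing_transducer (machine b)"
proof -
  have "case trf b q ss of (q', ws, ms) \<Rightarrow> q' \<in> {..6} \<and> ws \<in> lists {..b + 4} \<and>
      length ws = 5 \<and> length ms = 5 \<and> ws ! 0 = ss ! 0"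
    if "q \<le> 6" "ss \<in> lists {..b + 4}" "length ss = 5" for q ss
  proof -
    have "ss ! i \<le> b + 4" if "i < 5" for i
      using \<open>ss \<in> lists {..b + 4}\<close> \<open>length ss = 5\<close> that by (metis atMost_iff in_listsD nth_mem)
    then have *: "ss ! 0 \<le> b + 4" "ss ! 1 \<le> b + 4" "ss ! 2 \<le> b + 4" "ss ! 3 \<le> b + 4" "ss ! 4 \<le> b + 4"
      by simp_all
    have "out b q (ss ! 0) \<le> b + 4" "nxt b q (ss ! 0) \<le> 6"
      using * that(1) by (auto simp: machine_simps)
    then show ?thesis using that * by (auto simp: trf_def Let_def mrk_def)
  qed
  then show ?thesis by (auto simp: turing_transducer_def blk_def)
qed

section \<open>Configurations during the two passes\<close>

definition st :: "nat \<Rightarrow> nat list \<Rightarrow> nat \<Rightarrow> nat" where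
  "st b x i = foldl (nxt b) q_init (take i x)"

definition ctr_cell :: "nat \<Rightarrow> nat list \<Rightarrow> nat \<Rightarrow> nat" where
  "ctr_cell b x i = out b (st b x i) (word_tape (blk b) x i)"

text \<open>Here \<open>t\<close> counts the cells already rewritten on the way right. With
  \<open>t = length x + 1\<close> the description stays valid on the way back until the marker is
  removed.\<close>

definition tapes_at :: "nat \<Rightarrow> nat list \<Rightarrow> nat \<Rightarrow> (nat \<Rightarrow> nat) list" where
  "tapes_at b x t =
     [word_tape (blk b) x,
      \<lambda>i. if i < t then if i = 0 \<and> x \<noteq> [] then mrk b else word_tape (blk b) (x @ [b + 1]) i else blk b,
      \<lambda>i. if i < t then word_tape (blk b) (x @ [b + 2]) i else blk b,
      \<lambda>i. if i < t then ctr_cell b x i else blk b,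
      \<lambda>i. if i < t then ctr_cell b x i else blk b]"

lemma st_Suc: "i < length x \<Longrightarrow> st b x (Suc i) = nxt b (st b x i) (x ! i)"
  by (simp add: st_def take_Suc_conv_app_nth)

lemma st_0 [simp]: "st b x 0 = q_init"
  by (simp add: st_def)

text \<open>Keeps the forward states after the first step apart from \<open>q_init\<close>,
  \<open>q_back\<close> and \<open>q_fin\<close>.\<close>

lemma st_le: "0 < i \<Longrightarrow> i \<le> length x \<Longrightarrow> st b x i \<le> 3"
proof (induction i)
  case (Suc i)
  then have "i < length x" by simp
  then show ?case
    using Suc by (cases "i = 0") (auto simp: st_Suc nxt_def carrying_def)
qed simp

lemma step_machine:
  assumes "length ts = 5"
  shows "step (machine b) \<lparr>state = q, tapes = ts, heads = replicate 5 p\<rparr> =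
    (let (q', ws, ms) = trf b q (map (\<lambda>i. (ts ! i) p) [0,1,2,3,4]) in
     \<lparr>state = q', tapes = map (\<lambda>i. (ts ! i)(p := ws ! i)) [0,1,2,3,4],
      heads = map (\<lambda>i. move_head (ms ! i) p) [0,1,2,3,4]\<rparr>)"
proof -
  have "[0..<5] = [0,1,2,3,4::nat]" by (simp add: upt_rec numeral_eq_Suc)
  then show ?thesis by (simp add: step_def Let_def case_prod_beta)
qed

lemma replicate_5: "replicate 5 a = [a, a, a, a, a]"
  by (simp add: numeral_eq_Suc)

lemma config_forward:
  assumes x: "x \<in> lists {..b + 2}"
  shows "t \<le> length x \<Longrightarrow>
    config_at (machine b) x t = \<lparr>state = st b x t, tapes = tapes_at b x t, heads = replicate 5 t\<rparr>"
proof (induction t)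
  case 0
  then show ?case
    by (auto simp: config_at_def init_config_def tapes_at_def word_tape_def fun_eq_iff numeral_eq_Suc)
next
  case (Suc t)
  then have t: "t < length x" by simp
  have "x ! t \<le> b + 2" using x t by (metis atMost_iff in_listsD nth_mem)
  then have xt: "word_tape (blk b) x t = x ! t" "x ! t \<noteq> blk b"
    using t by (auto simp: word_tape_def blk_def)
  have q: "st b x t \<noteq> q_back" "st b x t = q_init \<longleftrightarrow> t = 0"
    using st_le[of t x b] t by (cases "t = 0"; auto)+
  have "config_at (machine b) x (Suc t) = step (machine b) (config_at (machine b) x t)"
    by (simp add: config_at_def)
  also have "\<dots> = step (machine b) \<lparr>state = st b x t, tapes = tapes_at b x t, heads = replicate 5 t\<rparr>"
    using Suc by simp
  also have "\<dots> = \<lparr>state = st b x (Suc t), tapes = tapes_at b x (Suc t), heads = replicate 5 (Suc t)\<rparr>"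
    using t xt q
    by (subst step_machine)
       (auto simp: tapes_at_def trf_def Let_def st_Suc replicate_5 fun_eq_iff less_Suc_eq ctr_cell_def
          word_tape_def nth_append)
  finally show ?case .
qed

lemma config_Nil:
  "config_at (machine b) [] 1 =
     \<lparr>state = q_fin, tapes = tapes_at b [] 1, heads = replicate 5 0\<rparr>"
proof -
  have "config_at (machine b) [] 1 = step (machine b) (config_at (machine b) [] 0)"
    by (simp add: config_at_def)
  also have "\<dots> = step (machine b) \<lparr>state = q_init, tapes = tapes_at b [] 0, heads = replicate 5 0\<rparr>"
    using config_forward[of "[]" b 0] by simp
  also have "\<dots> = \<lparr>state = q_fin, tapes = tapes_at b [] 1, heads = replicate 5 0\<rparr>"
    by (subst step_machine)
       (auto simp: tapes_at_def trf_def Let_def replicate_5 fun_eq_iff less_Suc_eq ctr_cell_def word_tape_def)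
  finally show ?thesis .
qed

text \<open>The step taken at time \<open>length x\<close>, on the first blank cell, is the turn: it
  writes the appended junk and any new top digit. The later steps before cell 0 leave the tapes
  unchanged.\<close>

lemma config_backward:
  assumes x: "x \<in> lists {..b + 2}" and "x \<noteq> []"
  shows "j < length x \<Longrightarrow> config_at (machine b) x (Suc (length x + j)) =
    \<lparr>state = q_back, tapes = tapes_at b x (Suc (length x)), heads = replicate 5 (length x - Suc j)\<rparr>"
proof (induction j)
  case 0
  have q: "st b x (length x) \<noteq> q_back" "st b x (length x) \<noteq> q_init"
    using st_le[of "length x" x b] assms(2) by auto
  have "config_at (machine b) x (Suc (length x + 0)) = step (machine b) (config_at (machine b) x (length x))"
    by (simp add: config_at_def)
  also have "\<dots> = step (machine b) \<lparr>state = st b x (length x), tapes = tapes_at b x (length x),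
      heads = replicate 5 (length x)\<rparr>"
    using config_forward[OF x] by simp
  also have "\<dots> = \<lparr>state = q_back, tapes = tapes_at b x (Suc (length x)), heads = replicate 5 (length x - 1)\<rparr>"
    using q assms(2)
    by (subst step_machine)
       (auto simp: tapes_at_def trf_def Let_def replicate_5 fun_eq_iff less_Suc_eq ctr_cell_def
          word_tape_def nth_append)
  finally show ?case by simp
next
  case (Suc j)
  define p where "p = length x - Suc j"
  have p: "0 < p" "p < length x" using Suc by (auto simp: p_def)
  \<comment> \<open>Away from cell 0 the first output tape holds input letters here, and the marker
    is not one of them.\<close>
  have "x ! p \<le> b + 2" using x p by (metis atMost_iff in_listsD nth_mem)
  then have m: "word_tape (blk b) (x @ [b + 1]) p \<noteq> mrk b"
    using p by (auto simp: word_tape_def mrk_def nth_append)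
  have "config_at (machine b) x (Suc (length x + Suc j)) =
      step (machine b) (config_at (machine b) x (Suc (length x + j)))"
    by (simp add: config_at_def)
  also have "\<dots> = step (machine b)
      \<lparr>state = q_back, tapes = tapes_at b x (Suc (length x)), heads = replicate 5 p\<rparr>"
    using Suc by (simp add: p_def)
  also have "\<dots> = \<lparr>state = q_back, tapes = tapes_at b x (Suc (length x)), heads = replicate 5 (p - 1)\<rparr>"
    using p m
    by (subst step_machine) (auto simp: tapes_at_def trf_def Let_def replicate_5 fun_eq_iff)
  finally show ?case by (simp add: p_def)
qed

text \<open>\<open>run\<close> stops at the first blank output while the machine continues; from
  then on the state is \<open>q_drop\<close>, which writes only blanks.\<close>

lemma nth_out_run:
  "2 \<le> b \<Longrightarrow> out b (foldl (nxt b) q (take i x)) (word_tape (blk b) x i) =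
     (if i \<le> length x then word_tape (blk b) (run b q x) i else out b (foldl (nxt b) q x) (blk b))"
proof (induction x arbitrary: i q)
  case Nil
  then show ?case by (auto simp: word_tape_def)
next
  case (Cons s x)
  have tape: "word_tape (blk b) (s # x) (Suc k) = word_tape (blk b) x k" for s x k
    by (simp add: word_tape_def)
  show ?case
  proof (cases i)
    case 0
    then show ?thesis by (auto simp: word_tape_def)
  next
    case (Suc k)
    have "run b (nxt b q s) x = []" if "out b q s = blk b"
    proof -
      have "q = q_drop \<or> b < s"
        using that by (auto simp: machine_simps split: if_splits)
      then have "nxt b q s = q_drop" by (auto simp: nxt_def)
      then show ?thesis by (simp add: run_drop)
    qed
    then show ?thesis
      using Suc Cons.IH[OF Cons.prems, of "nxt b q s" k] tape
      by (auto simp: word_tape_def)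
  qed
qed

text \<open>\<open>inc b x\<close> has at most one letter more than \<open>x\<close>, so the
  \<open>length x + 1\<close> visited cells hold all of it.\<close>

lemma ctr_cell_run:
  assumes "2 \<le> b"
  shows "(\<lambda>i. if i < Suc (length x) then ctr_cell b x i else blk b) = word_tape (blk b) (inc b x)"
proof -
  have "length (run b q y) \<le> Suc (length y)" for q y
    by (induction y arbitrary: q) auto
  from this[of q_init x] show ?thesis
    using nth_out_run[OF assms, of q_init _ x]
    by (auto simp: fun_eq_iff ctr_cell_def st_def word_tape_def less_Suc_eq_le split: if_splits)
qed

section \<open>Halting configuration, outputs and language\<close>

definition images :: "nat \<Rightarrow> nat list \<Rightarrow> nat list list" where
  "images b x = [x @ [b + 1], x @ [b + 2], inc b x, inc b x]"

lemma length_images [simp]: "length (images b x) = 4"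
  by (simp add: images_def)

text \<open>The last step is taken on cell 0: it replaces the marker by the input letter, and its
  left move leaves the heads there. For the empty word it is the only step, without a
  marker.\<close>

lemma config_final:
  assumes x: "x \<in> lists {..b + 2}" and b: "2 \<le> b"
  shows "config_at (machine b) x (Suc (2 * length x)) =
    \<lparr>state = q_fin,
     tapes = map (word_tape (blk b)) (x # images b x),
     heads = replicate 5 0\<rparr>"
proof (cases "x = []")
  case True
  then show ?thesis
    using config_Nil[of b] ctr_cell_run[OF b, of x]
    by (auto simp: tapes_at_def word_tape_def fun_eq_iff ctr_cell_def images_def)
next
  case False
  have "config_at (machine b) x (Suc (2 * length x)) =
      step (machine b) (config_at (machine b) x (Suc (length x + (length x - 1))))"
    using False by (cases x) (simp_all add: config_at_def mult_2)
  also have "\<dots> = step (machine b)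
      \<lparr>state = q_back, tapes = tapes_at b x (Suc (length x)), heads = replicate 5 0\<rparr>"
    using config_backward[OF x False, of "length x - 1"] False by (simp add: Suc_diff_Suc)
  also have "\<dots> = \<lparr>state = q_fin,
     tapes = map (word_tape (blk b)) (x # images b x),
     heads = replicate 5 0\<rparr>"
    using False
    by (subst step_machine)
       (auto simp: tapes_at_def ctr_cell_run[OF b] trf_def Let_def images_def replicate_5 fun_eq_iff word_tape_def nth_append)
  finally show ?thesis .
qed

lemma halts_machine:
  assumes x: "x \<in> lists {..b + 2}" and b: "2 \<le> b"
  shows "halts_at (machine b) x (Suc (2 * length x))"
proof -
  have "state (config_at (machine b) x t) \<noteq> q_fin" if "t < Suc (2 * length x)" for t
  proof (cases "t \<le> length x")
    case True
    then show ?thesis using config_forward[OF x True] st_le[of t x b] by (cases "t = 0") auto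
  next
    case False
    then obtain j where "t = Suc (length x + j)" by (metis less_iff_Suc_add not_le)
    moreover have "x \<noteq> []" using False that by auto
    ultimately show ?thesis using config_backward[OF x, of j] that by simp
  qed
  then show ?thesis using config_final[OF assms] by (simp add: halts_at_def)
qed

lemma two_pass_machine:
  assumes x: "x \<in> lists {..b + 2}" and b: "2 \<le> b"
  shows "two_pass_run (machine b) 0 x"
proof -
  have "heads (config_at (machine b) x t) = replicate 5 (2 * length x - t)"
    if t: "length x \<le> t" "t \<le> Suc (2 * length x)" for t
  proof -
    consider "t = length x" | "t = Suc (2 * length x)" |
      j where "t = Suc (length x + j)" "j < length x"
    proof (cases "t = length x \<or> t = Suc (2 * length x)")
      case False
      then have "t = Suc (length x + (t - Suc (length x)))" "t - Suc (length x) < length x"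
        using t by auto
      then show ?thesis using that by blast
    qed (use that in blast)
    then show ?thesis
    proof cases
      case (3 j)
      then have "x \<noteq> []" by auto
      then show ?thesis using 3 config_backward[OF x, of j] by simp
    qed (use config_forward[OF x] config_final[OF assms] in simp_all)
  qed
  \<comment> \<open>Turning on the first blank cell gives overshoot 0; the step beyond
    \<open>2 * length x\<close> rewrites the leftmost cells.\<close>
  then show ?thesis
    unfolding two_pass_run_def using halts_machine[OF assms] config_forward[OF x]
    by (intro exI[of _ "length x"] exI[of _ "Suc (2 * length x)"]) simp
qed

lemma images_in_lists:
  assumes "x \<in> lists {..b + 2}" "2 \<le> b"
  shows "set (images b x) \<subseteq> lists {..b + 2}"
proof -
  have "set (inc b x) \<subseteq> {..b + 2}"
    using run_in_digits[OF assms(2), of q_init x] by auto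
  then show ?thesis using assms(1) by (auto simp: images_def lists_eq_set)
qed

lemma translates_machine:
  assumes "x \<in> lists {..b + 2}" "2 \<le> b"
  shows "translates (machine b) x (images b x)"
proof -
  have "tapes (config_at (machine b) x (Suc (2 * length x))) ! (i + 1) =
      word_tape (blk b) (images b x ! i)" if "i < 4" for i
    using that by (simp add: config_final[OF assms])
  then show ?thesis
    unfolding translates_def using halts_machine[OF assms] images_in_lists[OF assms]
    by auto
qed

lemma outputs_machine:
  assumes "x \<in> lists {..b + 2}" "2 \<le> b"
  shows "outputs (machine b) x = images b x"
  unfolding outputs_def
  using translates_machine[OF assms] translates_unique[of "machine b"]
  by (intro the_equality) (auto simp: blk_def)

lemma lang_machine:
  assumes b: "2 \<le> b"
  shows "lang (machine b) = lists {..b + 2}"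
proof -
  have "state (config_at (machine b) x (Suc (2 * length x))) = q_fin" if "x \<in> lists {..b + 2}" for x
    using config_final[OF that b] by simp
  then show ?thesis
    unfolding lang_def machine_sel using halts_machine[OF _ b] by blast
qed

lemma machine_in_class_T:
  assumes b: "2 \<le> b"
  shows "machine b \<in> class_T"
proof -
  have "\<exists>ys. translates (machine b) x ys \<and> set ys \<subseteq> lang (machine b)" if "x \<in> lang (machine b)" for x
    using that translates_machine[OF _ b] images_in_lists[OF _ b] unfolding lang_machine[OF b] by blast
  moreover have "\<forall>x \<in> lists (in_alph (machine b)). two_pass_run (machine b) 0 x"
    using two_pass_machine[OF _ b] by simp
  ultimately show ?thesis
    using turing_transducer_machine unfolding class_T_def by blast
qed


section \<open>Growth\<close>

lemma gen_set_machine_subset: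
  assumes b: "2 \<le> b" and w: "w \<in> lists {..b + 2}"
  shows "gen_set (machine b) w n \<subseteq> lists {..b + 2}"
proof (induction n)
  case (Suc n)
  have "set (outputs (machine b) u) \<subseteq> lists {..b + 2}" if "u \<in> gen_set (machine b) w n" for u
    using subsetD[OF Suc that] images_in_lists[OF _ b] outputs_machine[OF _ b] by metis
  then show ?case unfolding gen_set.simps by (rule UN_least)
qed (use w in simp)

lemma set_mset_gen_mset: "set_mset (gen_mset T w n) = gen_set T w n"
  by (induction n) simp_all

lemma growth_machine:
  assumes b: "2 \<le> b" and w: "w \<in> lists {..b + 2}"
  shows "exponential_growth (growth (machine b) w)"
proof -
  let ?S = "\<lambda>n. {s. set s \<subseteq> {b + 1, b + 2} \<and> length s = n}"
  have fin: "finite (gen_set (machine b) w n)" for n by (induction n) auto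
  \<comment> \<open>On branches that only append junk nothing is forgotten, so every junk string of
    length \<open>n\<close> occurs behind \<open>w\<close>.\<close>
  have ext: "(\<lambda>s. w @ s) ` ?S n \<subseteq> gen_set (machine b) w n" for n
  proof (induction n)
    case (Suc n)
    show ?case
    proof
      fix y assume "y \<in> (\<lambda>s. w @ s) ` ?S (Suc n)"
      then obtain s where s: "y = w @ s" "set s \<subseteq> {b + 1, b + 2}" "length s = Suc n" by blast
      obtain u a where u: "s = u @ [a]" using s(3) by (cases s rule: rev_cases) auto
      then have "w @ u \<in> gen_set (machine b) w n" using Suc s by auto
      moreover from this have "outputs (machine b) (w @ u) = images b (w @ u)"
        using gen_set_machine_subset[OF b w] outputs_machine[OF _ b] by blast
      then have "y \<in> set (outputs (machine b) (w @ u))"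
        using s u by (auto simp: images_def)
      ultimately show "y \<in> gen_set (machine b) w (Suc n)" by auto
    qed
  qed auto
  have "2 ^ n \<le> growth (machine b) w n" for n
  proof -
    have "2 ^ n = card ((\<lambda>s. w @ s) ` ?S n)"
      by (subst card_image) (auto simp: card_lists_length_eq inj_on_def numeral_2_eq_2)
    also have "\<dots> \<le> card (\<Union>i\<le>n. gen_set (machine b) w i)"
      using ext[of n] fin by (intro card_mono) auto
    finally show ?thesis by (simp add: growth_def)
  qed
  then have "\<forall>n. real (growth (machine b) w n) \<ge> 1 * 2 ^ n"
    by (metis mult_1 of_nat_le_iff of_nat_numeral of_nat_power)
  then show ?thesis unfolding exponential_growth_def by (intro exI[of _ 1] exI[of _ 2]) simp
qed

section \<open>Average length as a binomial mean\<close>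

lemma sum_mset_gen_mset_Suc:
  "(\<Sum>w\<in>#gen_mset T w0 (Suc n). f w) = (\<Sum>w\<in>#gen_mset T w0 n. \<Sum>y\<leftarrow>outputs T w. f y)"
proof -
  have "(\<Sum>w\<in>#(\<Sum>u\<in>#M. mset (outputs T u)). f w) = (\<Sum>u\<in>#M. \<Sum>y\<leftarrow>outputs T u. f y)" for M
    by (induction M) (simp_all add: sum_mset_sum_list flip: mset_map)
  then show ?thesis by simp
qed

text \<open>The weight 2 stems from the duplicated counter output; it makes an increment as likely
  as an appended junk letter.\<close>

lemma sum_mset_gen_mset_Suc_machine:
  fixes f :: "nat list \<Rightarrow> real"
  assumes b: "2 \<le> b" and w: "w \<in> lists {..b + 2}"
  shows "(\<Sum>u\<in>#gen_mset (machine b) w (Suc n). f u) =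
    (\<Sum>u\<in>#gen_mset (machine b) w n. f (u @ [b + 1]) + f (u @ [b + 2]) + 2 * f (inc b u))"
proof -
  have "outputs (machine b) u = images b u" if "u \<in># gen_mset (machine b) w n" for u
    using that gen_set_machine_subset[OF assms, of n]
    by (intro outputs_machine[OF _ b]) (auto simp only: set_mset_gen_mset)
  then show ?thesis
    unfolding sum_mset_gen_mset_Suc
    by (intro arg_cong[of _ _ sum_mset] image_mset_cong) (simp add: images_def)
qed

lemma size_gen_mset_machine:
  assumes "2 \<le> b" "w \<in> lists {..b + 2}"
  shows "size (gen_mset (machine b) w n) = 4 ^ n"
proof -
  have "(\<Sum>u\<in>#gen_mset (machine b) w n. 1 :: real) = 4 ^ n"
  proof (induction n)
    case (Suc n)
    then show ?case unfolding sum_mset_gen_mset_Suc_machine[OF assms]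
      by (simp add: sum_mset_constant)
  qed simp
  then have "real (size (gen_mset (machine b) w n)) = real (4 ^ n)" by simp
  then show ?thesis by (simp only: of_nat_eq_iff)
qed

text \<open>
  Incrementing forgets the junk, so \<open>length ((inc b ^^ i) u)\<close> is not affected by appending junk to \<open>u\<close>
  when \<open>i > 0\<close>. The sums therefore satisfy Pascal's recursion, up to a defect at \<open>i = 0\<close>.
\<close>
lemma sum_mset_length_gen_mset_machine:
  assumes b: "2 \<le> b" and w: "w \<in> lists {..b + 2}"
  shows "(\<Sum>u\<in>#gen_mset (machine b) w n. real (length ((inc b ^^ i) u))) =
    2 ^ n * (\<Sum>j\<le>n. real (n choose j) * real (length ((inc b ^^ (i + j)) w)))
      + of_bool (i = 0) * (4 ^ n - 2 ^ n)"
\<comment> \<open>\<open>i\<close> varies, since the outputs \<open>inc b u\<close> lead from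
  \<open>i\<close> to \<open>i + 1\<close>.\<close>
proof (induction n arbitrary: i)
  case (Suc n)
  let ?q = "\<lambda>i u. real (length ((inc b ^^ i) u))"
  let ?M = "gen_mset (machine b) w n"
  have shift: "(inc b ^^ k) (inc b u) = (inc b ^^ Suc k) u" for k u
    by (simp add: funpow_swap1)
  have snoc: "?q i (u @ [a]) = ?q i u + of_bool (i = 0)" if "b < a" for u a
  proof (cases i)
    case (Suc k)
    have "(inc b ^^ Suc k) (u @ [a]) = (inc b ^^ Suc k) u"
      unfolding shift[symmetric] run_snoc[OF that] ..
    then show ?thesis using Suc by simp
  qed simp
  define A where "A = (\<Sum>j\<le>n. real (n choose j) * ?q (i + j) w)"
  define B where "B = (\<Sum>j\<le>n. real (n choose j) * ?q (i + Suc j) w)"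
  have pascal: "A + B = (\<Sum>j\<le>Suc n. real (Suc n choose j) * ?q (i + j) w)"
  proof -
    have "A = (\<Sum>j\<le>Suc n. real (n choose j) * ?q (i + j) w)"
      by (simp add: A_def)
    then have "A = ?q i w + (\<Sum>j\<le>n. real (n choose Suc j) * ?q (i + Suc j) w)"
      by (simp only: sum.atMost_Suc_shift) simp
    then show ?thesis
      unfolding B_def sum.atMost_Suc_shift by (simp add: sum.distrib algebra_simps)
  qed
  have IH: "(\<Sum>u\<in>#?M. ?q i u) = 2 ^ n * A + of_bool (i = 0) * (4 ^ n - 2 ^ n)"
    "(\<Sum>u\<in>#?M. ?q (Suc i) u) = 2 ^ n * B"
    using Suc.IH[of i] Suc.IH[of "Suc i", unfolded add_Suc_shift] by (simp_all add: A_def B_def)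
  have "(\<Sum>u\<in>#gen_mset (machine b) w (Suc n). ?q i u) =
      (\<Sum>u\<in>#?M. 2 * ?q i u + 2 * ?q (Suc i) u + 2 * of_bool (i = 0))"
  proof -
    have "?q i (u @ [b + 1]) + ?q i (u @ [b + 2]) + 2 * ?q i (inc b u) =
        2 * ?q i u + 2 * ?q (Suc i) u + 2 * of_bool (i = 0)" for u
      unfolding shift using snoc[of "b + 1" u] snoc[of "b + 2" u] by linarith
    then show ?thesis by (simp only: sum_mset_gen_mset_Suc_machine[OF b w])
  qed
  also have "\<dots> = 2 * (\<Sum>u\<in>#?M. ?q i u) + 2 * (\<Sum>u\<in>#?M. ?q (Suc i) u) + 2 * of_bool (i = 0) * 4 ^ n"
    by (simp add: sum_mset.distrib sum_mset_distrib_left[symmetric] size_gen_mset_machine[OF b w])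
  \<comment> \<open>For \<open>i = 0\<close> the defect obeys
    \<open>d (n + 1) = 2 * d n + 2 * 4 ^ n\<close> with \<open>d 0 = 0\<close>, solved by
    \<open>4 ^ n - 2 ^ n\<close>.\<close>
  also have "\<dots> = 2 ^ Suc n * (A + B) + of_bool (i = 0) * (4 ^ Suc n - 2 ^ Suc n)"
    unfolding IH by (simp add: algebra_simps)
  finally show ?case unfolding pascal .
qed simp

lemma sum_count_eq_sum_mset:
  "(\<Sum>x\<in>set_mset M. real (count M x) * f x) = (\<Sum>x\<in>#M. f x)"
proof (induction M)
  case (add a M)
  have "(\<Sum>x\<in>set_mset (add_mset a M). real (count (add_mset a M) x) * f x) =
      (\<Sum>x\<in>insert a (set_mset M). real (count M x) * f x + (if x = a then f x else 0))"
    by (rule sum.cong) (auto simp: algebra_simps)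
  also have "\<dots> = (\<Sum>x\<in>insert a (set_mset M). real (count M x) * f x) + f a"
    by (simp add: sum.distrib)
  also have "(\<Sum>x\<in>insert a (set_mset M). real (count M x) * f x) =
      (\<Sum>x\<in>set_mset M. real (count M x) * f x)"
    by (rule sum.mono_neutral_right) (auto simp: not_in_iff)
  finally show ?case using add by simp
qed simp

text \<open>\<open>j\<close> is the number of increments on a random path, binomial with probability
  1/2; \<open>1 - 1 / 2 ^ n\<close> is the mean length of the junk appended since the last
  increment, or since the start if there is none.\<close>

lemma avg_length_machine:
  assumes "2 \<le> b" "w \<in> lists {..b + 2}"
  shows "avg_length (machine b) w n =
    (\<Sum>j\<le>n. real (n choose j) * real (length ((inc b ^^ j) w))) / 2 ^ n + 1 - 1 / 2 ^ n"
proof -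
  have "(\<Sum>u\<in>#gen_mset (machine b) w n. real (length u)) =
      2 ^ n * (\<Sum>j\<le>n. real (n choose j) * real (length ((inc b ^^ j) w))) + (4 ^ n - 2 ^ n)"
    using sum_mset_length_gen_mset_machine[OF assms, where n = n and i = 0] by simp
  moreover have "(4 :: real) ^ n = 2 ^ n * 2 ^ n" by (simp flip: power_mult_distrib)
  ultimately show ?thesis
    unfolding avg_length_def sum_count_eq_sum_mset by (simp only: machine_sel) (simp add: field_simps)
qed

text \<open>Pairing the terms \<open>j\<close> and \<open>n - j\<close>, one of which is at least \<open>n / 2\<close>.\<close>
lemma binomial_average_ge:
  fixes f :: "nat \<Rightarrow> real"
  assumes nonneg: "\<And>j. 0 \<le> f j" and ge: "\<And>j. n \<le> 2 * j \<Longrightarrow> m \<le> f j"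
  shows "m / 2 \<le> (\<Sum>j\<le>n. real (n choose j) * f j) / 2 ^ n"
proof -
  let ?S = "\<Sum>j\<le>n. real (n choose j) * f j"
  have "?S = (\<Sum>j\<le>n. real (n choose j) * f (n - j))"
    by (rule sum.reindex_bij_witness[of _ "\<lambda>j. n - j" "\<lambda>j. n - j"])
       (auto simp: binomial_symmetric[symmetric])
  then have "2 * ?S = (\<Sum>j\<le>n. real (n choose j) * (f j + f (n - j)))"
    by (simp add: sum.distrib algebra_simps)
  also have "\<dots> \<ge> (\<Sum>j\<le>n. real (n choose j) * m)"
  proof (intro sum_mono mult_left_mono)
    fix j assume "j \<in> {..n}"
    then have "n \<le> 2 * j \<or> n \<le> 2 * (n - j)" by auto
    then show "m \<le> f j + f (n - j)"
      using ge[of j] ge[of "n - j"] nonneg[of j] nonneg[of "n - j"] by linarith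
  qed simp
  also have "(\<Sum>j\<le>n. real (n choose j) * m) = 2 ^ n * m"
    using choose_row_sum[of n] by (simp flip: sum_distrib_right of_nat_sum)
  finally show ?thesis by (simp add: field_simps)
qed

text \<open>One constant must serve all \<open>n \<ge> 1\<close>, although the initial value costs
  an additive \<open>K\<close>. The junk term keeps the average at least 1/2, which converts that
  loss into a factor.\<close>

lemma avg_length_machine_lower:
  assumes b: "2 \<le> b" and w: "w \<in> lists {..b + 2}"
  shows "\<exists>\<delta>>0. \<forall>n\<ge>1. \<delta> * real n powr (ln (real b) / ln (real (Suc b))) \<le> avg_length (machine b) w n"
proof -
  define \<beta> where "\<beta> = ln (real b) / ln (real (Suc b))"
  have \<beta>: "0 < \<beta>" "\<beta> < 1" using b by (auto simp: \<beta>_def)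
  define K where "K = real (good_count b (Suc (val b (digits b w))))"
  have K: "0 \<le> K" by (simp add: K_def)
  have "real n powr \<beta> / (4 * real b * (K + 1)) \<le> avg_length (machine b) w n" if n: "1 \<le> n" for n
  proof -
    \<comment> \<open>\<open>(n + 1) div 2\<close> is the least \<open>j\<close> with
      \<open>n \<le> 2 * j\<close>.\<close>
    define g where "g = real (good_count b ((n + 1) div 2))"
    have g: "g - K \<le> real (length ((inc b ^^ j) w))" if "n \<le> 2 * j" for j
    proof -
      have "good_count b ((n + 1) div 2) \<le> good_count b (Suc (val b (digits b w) + j))"
        using that by (intro good_count_mono) auto
      then show ?thesis
        using length_inc_iterate(2)[OF b, of j w] that n by (simp add: g_def K_def)
    qed
    have "(g - K) / 2 \<le> (\<Sum>j\<le>n. real (n choose j) * real (length ((inc b ^^ j) w))) / 2 ^ n"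
      using g by (intro binomial_average_ge) auto
    moreover have "0 \<le> (\<Sum>j\<le>n. real (n choose j) * real (length ((inc b ^^ j) w))) / 2 ^ n"
      by (intro divide_nonneg_nonneg sum_nonneg) auto
    moreover have "1 / 2 ^ n \<le> (1 / 2 :: real)"
      using n self_le_power[of "2 :: real" n] by (simp add: field_simps)
    ultimately have a: "(g - K) / 2 \<le> avg_length (machine b) w n - 1 / 2"
        "1 / 2 \<le> avg_length (machine b) w n"
      unfolding avg_length_machine[OF b w] by linarith+
    have "g \<le> 2 * (K + 1) * avg_length (machine b) w n"
    proof -
      have "K * 1 \<le> K * (2 * avg_length (machine b) w n)"
        using a(2) K by (intro mult_left_mono) auto
      then show ?thesis using a(1) by (simp add: field_simps)
    qed
    moreover have "real n powr \<beta> \<le> 2 * real b * g"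
    proof -
      have "real n powr \<beta> \<le> (2 * real ((n + 1) div 2)) powr \<beta>"
        using \<beta> by (intro powr_mono2) auto
      also have "\<dots> = 2 powr \<beta> * real ((n + 1) div 2) powr \<beta>"
        by (simp add: powr_mult)
      also have "\<dots> \<le> 2 * (real b * g)"
        using good_count_powr_bounds(1)[OF b, of "(n + 1) div 2"] n b \<beta> powr_mono[of \<beta> 1 2]
        by (intro mult_mono) (auto simp: \<beta>_def g_def field_simps)
      finally show ?thesis by simp
    qed
    moreover have "2 * real b * g \<le> 2 * real b * (2 * (K + 1) * avg_length (machine b) w n)"
      using calculation(1) by (intro mult_left_mono) auto
    ultimately have "real n powr \<beta> \<le> 2 * real b * (2 * (K + 1) * avg_length (machine b) w n)"
      by linarith
    also have "\<dots> = avg_length (machine b) w n * (4 * real b * (K + 1))"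
      by simp
    finally have "real n powr \<beta> \<le> avg_length (machine b) w n * (4 * real b * (K + 1))" .
    then show ?thesis using b K by (subst pos_divide_le_eq) auto
  qed
  then show ?thesis
    using b K unfolding \<beta>_def[symmetric] by (intro exI[of _ "1 / (4 * real b * (K + 1))"]) auto
qed

lemma avg_length_machine_upper:
  assumes b: "2 \<le> b" and w: "w \<in> lists {..b + 2}"
  shows "\<exists>\<delta>. \<forall>n\<ge>1. avg_length (machine b) w n \<le> \<delta> * real n powr (ln (real b) / ln (real (Suc b)))"
proof -
  define \<beta> where "\<beta> = ln (real b) / ln (real (Suc b))"
  have \<beta>: "0 < \<beta>" using b by (auto simp: \<beta>_def)
  define v where "v = val b (digits b w)"
  \<comment> \<open>The summand 1 bounds the junk; the last one comes from
    \<open>v + 1 + n \<le> (v + 2) * n\<close> for \<open>n \<ge> 1\<close>.\<close>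
  define C where "C = real (length w) + 1 + real b * real (v + 2) powr \<beta>"
  have "avg_length (machine b) w n \<le> C * real n powr \<beta>" if n: "1 \<le> n" for n
  proof -
    define m where "m = real (length w) + real (good_count b (Suc (v + n)))"
    have "real (length ((inc b ^^ j) w)) \<le> m" if "j \<le> n" for j
      using length_inc_iterate(1)[OF b, of j w] good_count_mono[of "Suc (v + j)" "Suc (v + n)" b] that
      by (simp add: m_def v_def)
    then have "(\<Sum>j\<le>n. real (n choose j) * real (length ((inc b ^^ j) w))) \<le> (\<Sum>j\<le>n. real (n choose j) * m)"
      by (intro sum_mono mult_left_mono) auto
    also have "\<dots> = 2 ^ n * m"
      using choose_row_sum[of n] by (simp flip: sum_distrib_right of_nat_sum)
    finally have "(\<Sum>j\<le>n. real (n choose j) * real (length ((inc b ^^ j) w))) / 2 ^ n \<le> m"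
      by (simp add: field_simps)
    moreover have "0 \<le> (1 / 2 ^ n :: real)" by simp
    ultimately have "avg_length (machine b) w n \<le> m + 1"
      unfolding avg_length_machine[OF b w] by linarith
    also have "\<dots> \<le> C * real n powr \<beta>"
    proof -
      have "Suc (v + n) \<le> (v + 2) * n" using n by (cases n) auto
      then have "real (good_count b (Suc (v + n))) \<le> real (good_count b ((v + 2) * n))"
        using good_count_mono by (simp only: of_nat_le_iff)
      also have "\<dots> \<le> real b * real ((v + 2) * n) powr \<beta>"
        using good_count_powr_bounds(2)[OF b, of "(v + 2) * n"] n by (simp add: \<beta>_def)
      also have "\<dots> = real b * real (v + 2) powr \<beta> * real n powr \<beta>"
        by (simp only: of_nat_mult powr_mult of_nat_0_le_iff mult.assoc)
      finally have g: "real (good_count b (Suc (v + n))) \<le> real b * real (v + 2) powr \<beta> * real n powr \<beta>" .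
      have "1 \<le> real n powr \<beta>" using n \<beta> by (simp add: ge_one_powr_ge_zero)
      then have "(real (length w) + 1) * 1 \<le> (real (length w) + 1) * real n powr \<beta>"
        by (intro mult_left_mono) auto
      with g show ?thesis by (simp add: m_def C_def algebra_simps)
    qed
    finally show ?thesis .
  qed
  then show ?thesis unfolding \<beta>_def by blast
qed

lemma avg_length_machine_same_order:
  assumes b: "2 \<le> b" and w: "w \<in> lists {..b + 2}"
  shows "same_order (avg_length (machine b) w) (\<lambda>n. real n powr (ln (real b) / ln (real (Suc b))))"
proof -
  let ?f = "\<lambda>n. real n powr (ln (real b) / ln (real (Suc b)))"
  obtain d e where d: "0 < d" "\<And>n. 1 \<le> n \<Longrightarrow> d * ?f n \<le> avg_length (machine b) w n"
    and e: "\<And>n. 1 \<le> n \<Longrightarrow> avg_length (machine b) w n \<le> e * ?f n"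
    using avg_length_machine_lower[OF assms] avg_length_machine_upper[OF assms] by metis
  moreover from d(2)[of 1] e[of 1] have "d \<le> e" by simp
  ultimately show ?thesis unfolding same_order_def by blast
qed

text \<open>Since \<open>ln (b + 1) \<le> 1 + ln b\<close>, for positive \<open>\<alpha>\<close> it
  suffices that \<open>(1 - \<alpha>) * ln b > 1\<close>; otherwise positivity of the quotient is
  enough.\<close>

lemma exists_digit_exponent:
  fixes \<alpha> :: real
  assumes "\<alpha> < 1"
  shows "\<exists>b\<ge>2. \<alpha> < ln (real b) / ln (real (Suc b))"
proof -
  \<comment> \<open>The summand 2 gives both \<open>2 \<le> b\<close> and the strict inequality that
    follows.\<close>
  define b where "b = nat \<lceil>exp (1 / (1 - \<alpha>))\<rceil> + 2"
  have "exp (1 / (1 - \<alpha>)) < real b" unfolding b_def by linarith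
  then have "1 / (1 - \<alpha>) < ln (real b)"
    using ln_less_cancel_iff[of "exp (1 / (1 - \<alpha>))" "real b"]
    by (metis exp_gt_zero ln_exp order_less_trans)
  then have lnb: "1 < (1 - \<alpha>) * ln (real b)"
    using assms by (simp add: field_simps)
  have b2: "2 \<le> b" by (simp add: b_def)
  then have pos: "0 < ln (real b)" "0 < ln (real (Suc b))" by simp_all
  have "\<alpha> * ln (real (Suc b)) < ln (real b)"
  proof (cases "0 < \<alpha>")
    case True
    have "ln (real (Suc b)) \<le> ln (2 * real b)" using b2 by simp
    also have "\<dots> \<le> 1 + ln (real b)"
      using b2 ln_2_less_1 by (simp add: ln_mult)
    finally have "\<alpha> * ln (real (Suc b)) \<le> \<alpha> * (1 + ln (real b))"
      using True by (intro mult_left_mono) auto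
    then show ?thesis using lnb assms by (simp add: algebra_simps)
  next
    case False
    then have "\<alpha> * ln (real (Suc b)) \<le> 0" using pos by (intro mult_nonpos_nonneg) auto
    then show ?thesis using pos by linarith
  qed
  then show ?thesis using b2 pos by (intro exI[of _ b]) (simp add: pos_less_divide_eq)
qed

theorem theorem15:
  fixes \<alpha> :: real
  assumes "\<alpha> < 1"
  shows "\<exists>(T :: (nat, nat) transducer) (\<beta> :: real).
           T \<in> class_T \<and> \<alpha> < \<beta> \<and> \<beta> < 1 \<and> lang T \<noteq> {} \<and>
           (\<forall>w0 \<in> lang T.
              same_order (avg_length T w0) (\<lambda>n. real n powr \<beta>) \<and>
              exponential_growth (growth T w0))"
proof -
  obtain b where b: "2 \<le> b" and \<alpha>: "\<alpha> < ln (real b) / ln (real (Suc b))"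
    using exists_digit_exponent[OF assms] by blast
  have "ln (real b) / ln (real (Suc b)) < 1" using b by simp
  moreover have "lang (machine b) \<noteq> {}" using lang_machine[OF b] by auto
  ultimately show ?thesis
    using \<alpha> machine_in_class_T[OF b] avg_length_machine_same_order[OF b] growth_machine[OF b]
      lang_machine[OF b] by metis
qed

end
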